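(* Let $\Omega$ be a slice domain in $\mathbb{H}$ and let $f:\Omega\to\mathbb{H}$ be a slice regular function. If $x_0+y_0\mathbb{S}$ (with $x_0,y_0\in\mathbb{R}$) intersects $\Omega$ and if $C$ is a connected component of the intersection, then there exist an open neighborhood $U$ of $C$ and quaternions $\{a_k\}_{k\in\mathbb{N}}$ such that $$f(q)=\sum_{n\in\mathbb{N}}[(q-x_0)^2+y_0^2]^n\,[a_{2n}+q\,a_{2n+1}]$$ for all $q\in U$.
   Context: $\mathbb{H}$ is the real algebra of quaternions, $\mathbb{S}=\{J\in\mathbb{H}:J^2=-1\}$, $x_0+y_0\mathbb{S}=\{x_0+y_0J:J\in\mathbb{S}\}$, $L_I=\mathbb{R}+I\mathbb{R}$ and $T_I=T\cap L_I$ for $I\in\mathbb{S}$, $T\subseteq\mathbb{H}$; $\mathbb{N}$ includes $0$. A domain is a nonempty open connected set; a slice domain is a domain $\Omega\subseteq\mathbb{H}$ with $\Omega\cap\mathbb{R}\neq\emptyset$ such that $\Omega_I$ is a domain of $L_I$ for every $I\in\mathbb{S}$. A function $f:\Omega\to\mathbb{H}$ is slice regular if, for every $I\in\mathbb{S}$, the restriction $f_I$ of $f$ to $\Omega_I$ has continuous partial derivatives and $\frac12\left(\frac{\partial}{\partial x}+I\frac{\partial}{\partial y}\right)f_I(x+yI)\equiv0$. *)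

theory Defs
  imports "HOL-Analysis.Analysis"
begin

section \<open>The real algebra of quaternions\<close>

datatype quat = Quat (qre: real) (qi: real) (qj: real) (qk: real)

lemma quat_eq_iff:
  "p = q \<longleftrightarrow> qre p = qre q \<and> qi p = qi q \<and> qj p = qj q \<and> qk p = qk q"
  by (auto intro: quat.expand)

instantiation quat :: real_vector
begin

definition zero_quat :: quat where
  "0 = Quat 0 0 0 0"

definition uminus_quat :: "quat \<Rightarrow> quat" where
  "- p = Quat (- qre p) (- qi p) (- qj p) (- qk p)"

definition plus_quat :: "quat \<Rightarrow> quat \<Rightarrow> quat" where
  "p + q = Quat (qre p + qre q) (qi p + qi q) (qj p + qj q) (qk p + qk q)"

definition minus_quat :: "quat \<Rightarrow> quat \<Rightarrow> quat" where
  "p - q = Quat (qre p - qre q) (qi p - qi q) (qj p - qj q) (qk p - qk q)"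

definition scaleR_quat :: "real \<Rightarrow> quat \<Rightarrow> quat" where
  "r *\<^sub>R q = Quat (r * qre q) (r * qi q) (r * qj q) (r * qk q)"

lemmas quat_vector_defs =
  zero_quat_def uminus_quat_def plus_quat_def minus_quat_def scaleR_quat_def

instance
  by standard (auto simp: quat_vector_defs quat_eq_iff algebra_simps)

end

instantiation quat :: "{one, times, inverse}"
begin

definition one_quat :: quat where
  "1 = Quat 1 0 0 0"

definition times_quat :: "quat \<Rightarrow> quat \<Rightarrow> quat" where
  "p * q = Quat
     (qre p * qre q - qi p * qi q - qj p * qj q - qk p * qk q)
     (qre p * qi q + qi p * qre q + qj p * qk q - qk p * qj q)
     (qre p * qj q - qi p * qk q + qj p * qre q + qk p * qi q)
     (qre p * qk q + qi p * qj q - qj p * qi q + qk p * qre q)"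

definition inverse_quat :: "quat \<Rightarrow> quat" where
  "inverse q = (let n = (qre q)\<^sup>2 + (qi q)\<^sup>2 + (qj q)\<^sup>2 + (qk q)\<^sup>2
     in Quat (qre q / n) (- qi q / n) (- qj q / n) (- qk q / n))"

definition divide_quat :: "quat \<Rightarrow> quat \<Rightarrow> quat" where
  "p div q = p * inverse (q :: quat)"

instance ..

end

lemmas quat_mult_defs = one_quat_def times_quat_def

lemma quat_sum_squares_eq_0_iff:
  "(qre q)\<^sup>2 + (qi q)\<^sup>2 + (qj q)\<^sup>2 + (qk q)\<^sup>2 = 0 \<longleftrightarrow> q = 0"
  by (auto simp: quat_eq_iff zero_quat_def add_nonneg_eq_0_iff)

instance quat :: real_algebra_1
  by standard (auto simp: quat_vector_defs quat_mult_defs quat_eq_iff algebra_simps)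

instance quat :: real_div_algebra
proof
  fix p q :: quat
  define n where "n = (qre q)\<^sup>2 + (qi q)\<^sup>2 + (qj q)\<^sup>2 + (qk q)\<^sup>2"
  have inv: "inverse q = Quat (qre q / n) (- qi q / n) (- qj q / n) (- qk q / n)"
    by (simp add: inverse_quat_def n_def Let_def)
  show "p / q = p * inverse q"
    by (simp add: divide_quat_def)
  assume "q \<noteq> 0"
  then have n: "n \<noteq> 0"
    using quat_sum_squares_eq_0_iff n_def by simp
  have n': "qre q * qre q + qi q * qi q + qj q * qj q + qk q * qk q = n"
    by (simp add: n_def power2_eq_square)
  show "q * inverse q = 1" "inverse q * q = 1"
    using n n'
    by (simp_all add: inv quat_mult_defs mult.commute
        add_divide_distrib [symmetric] diff_divide_distrib [symmetric])
next
  show "inverse (0::quat) = 0"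
    by (simp add: inverse_quat_def zero_quat_def)
qed

instantiation quat :: real_inner
begin

definition inner_quat :: "quat \<Rightarrow> quat \<Rightarrow> real" where
  "inner_quat p q = qre p * qre q + qi p * qi q + qj p * qj q + qk p * qk q"

definition norm_quat :: "quat \<Rightarrow> real" where
  "norm_quat q = sqrt ((qre q)\<^sup>2 + (qi q)\<^sup>2 + (qj q)\<^sup>2 + (qk q)\<^sup>2)"

definition sgn_quat :: "quat \<Rightarrow> quat" where
  "sgn_quat q = q /\<^sub>R norm q"

definition dist_quat :: "quat \<Rightarrow> quat \<Rightarrow> real" where
  "dist_quat p q = norm (p - q)"

definition uniformity_quat :: "(quat \<times> quat) filter" where
  "uniformity_quat = (INF e\<in>{0<..}. principal {(p, q). dist p q < e})"

definition open_quat :: "quat set \<Rightarrow> bool" where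
  "open_quat U \<longleftrightarrow> (\<forall>p\<in>U. eventually (\<lambda>(p', q). p' = p \<longrightarrow> q \<in> U) uniformity)"

instance
proof
  fix p q r :: quat and c :: real and U :: "quat set"
  show "dist p q = norm (p - q)"
    by (simp add: dist_quat_def)
  show "sgn q = q /\<^sub>R norm q"
    by (simp add: sgn_quat_def)
  show "uniformity = (INF e\<in>{0<..}. principal {(p, q :: quat). dist p q < e})"
    by (simp add: uniformity_quat_def)
  show "open U \<longleftrightarrow> (\<forall>p\<in>U. eventually (\<lambda>(p', q). p' = p \<longrightarrow> q \<in> U) uniformity)"
    by (simp add: open_quat_def)
  show "inner p q = inner q p"
    by (simp add: inner_quat_def mult.commute)
  show "inner (p + q) r = inner p r + inner q r"
    by (simp add: inner_quat_def plus_quat_def algebra_simps)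
  show "inner (c *\<^sub>R p) q = c * inner p q"
    by (simp add: inner_quat_def scaleR_quat_def algebra_simps)
  show "0 \<le> inner p p"
    by (simp add: inner_quat_def)
  show "inner p p = 0 \<longleftrightarrow> p = 0"
    using quat_sum_squares_eq_0_iff [of p] by (simp add: inner_quat_def power2_eq_square)
  show "norm p = sqrt (inner p p)"
    by (simp add: inner_quat_def norm_quat_def power2_eq_square)
qed

end

instantiation quat :: euclidean_space
begin

definition Basis_quat :: "quat set" where
  "Basis_quat = {Quat 1 0 0 0, Quat 0 1 0 0, Quat 0 0 1 0, Quat 0 0 0 1}"

instance
proof
  fix p q :: quat
  show "(Basis :: quat set) \<noteq> {}" "finite (Basis :: quat set)"
    by (simp_all add: Basis_quat_def)
  show "p \<in> Basis \<Longrightarrow> q \<in> Basis \<Longrightarrow> inner p q = (if p = q then 1 else 0)"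
    unfolding Basis_quat_def by (elim insertE emptyE; simp add: inner_quat_def)
  show "(\<forall>u\<in>Basis. inner p u = 0) \<longleftrightarrow> p = 0"
    by (cases p) (simp add: Basis_quat_def inner_quat_def zero_quat_def)
qed

end

lemma four_squares_identity:
  fixes a b c d s t u v :: real
  shows "(a * s - b * t - c * u - d * v)\<^sup>2 + (a * t + b * s + c * v - d * u)\<^sup>2 +
      (a * u - b * v + c * s + d * t)\<^sup>2 + (a * v + b * u - c * t + d * s)\<^sup>2 =
    (a\<^sup>2 + b\<^sup>2 + c\<^sup>2 + d\<^sup>2) * (s\<^sup>2 + t\<^sup>2 + u\<^sup>2 + v\<^sup>2)"
  by algebra

instance quat :: real_normed_div_algebra
proof
  fix p q :: quat
  show "norm (p * q) = norm p * norm q"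
    by (simp add: norm_quat_def times_quat_def four_squares_identity real_sqrt_mult)
qed


section \<open>Slice domains and slice regular functions\<close>

definition imag_units :: "quat set"  (\<open>\<S>\<close>) where
  "\<S> = {J. J\<^sup>2 = - 1}"

definition quat_slice :: "quat \<Rightarrow> quat set" where
  "quat_slice I = {of_real x + of_real y * I | x y. True}"

definition quat_sphere :: "real \<Rightarrow> real \<Rightarrow> quat set" where
  "quat_sphere x0 y0 = {of_real x0 + of_real y0 * J | J. J \<in> \<S>}"

definition slice_domain :: "quat set \<Rightarrow> bool" where
  "slice_domain \<Omega> \<longleftrightarrow>
     open \<Omega> \<and> connected \<Omega> \<and> \<Omega> \<inter> \<real> \<noteq> {} \<and>
     (\<forall>I\<in>\<S>. \<Omega> \<inter> quat_slice I \<noteq> {} \<and>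
        openin (top_of_set (quat_slice I)) (\<Omega> \<inter> quat_slice I) \<and>
        connected (\<Omega> \<inter> quat_slice I))"

text \<open>
  For \<^term>\<open>I \<in> \<S>\<close>, the restriction of \<open>f\<close> to the slice is viewed as a function of the real
  coordinates \<open>(x, y)\<close>, ranging over \<open>D\<close>; \<open>fx\<close> and \<open>fy\<close> are its partial derivatives.
  The definition is meant for open \<open>\<Omega>\<close>: then the sections of \<open>D\<close> are open, so the derivatives
  depend only on the values of \<open>f\<close> on \<open>\<Omega>\<close>.
\<close>

definition slice_regular_on :: "quat set \<Rightarrow> (quat \<Rightarrow> quat) \<Rightarrow> bool" where
  "slice_regular_on \<Omega> f \<longleftrightarrow>
     (\<forall>I\<in>\<S>. let D = {(x, y). of_real x + of_real y * I \<in> \<Omega>} in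
        \<exists>fx fy :: real \<times> real \<Rightarrow> quat.
          continuous_on D fx \<and> continuous_on D fy \<and>
          (\<forall>(x, y)\<in>D.
             ((\<lambda>s. f (of_real s + of_real y * I)) has_vector_derivative fx (x, y)) (at x) \<and>
             ((\<lambda>t. f (of_real x + of_real t * I)) has_vector_derivative fy (x, y)) (at y) \<and>
             (1 / 2) *\<^sub>R (fx (x, y) + I * fy (x, y)) = 0))"

end

theory Submission
  imports Defs "HOL-Complex_Analysis.Conformal_Mappings"
begin

text \<open>
  Write a quaternion as \<open>x + y L\<close> with \<open>z = x + y i\<close> in the closed upper half-plane and \<open>L \<in> \<S>\<close>. The
  key point is a local representation: near every \<open>p \<in> \<Omega>\<close> there are functions \<open>\<alpha>\<close> and \<open>\<beta>\<close> of \<open>z\<close>,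
  satisfying the Cauchy-Riemann equations, such that \<open>f (x + y L) = \<alpha> z + L \<beta> z\<close>. To obtain it, join
  \<open>p\<close> to a real point by a path inside its slice. By compactness, the copies of a neighborhood of this
  path in all nearby slices remain in \<open>\<Omega>\<close> (\<open>slice_tube\<close>). The values of \<open>f\<close> on two of these slices
  define \<open>\<alpha>\<close> and \<open>\<beta>\<close>, and on each of the others \<open>f\<close> and \<open>\<alpha> + L \<beta>\<close> are holomorphic and agree on the
  real axis, hence everywhere by the identity theorem (\<open>stem_exists\<close>). At a nonreal point the germ of
  \<open>(\<alpha>, \<beta>)\<close> is determined by \<open>f\<close>, so a connected set \<open>C\<close> inside a sphere has one pair \<open>(\<alpha>, \<beta>)\<close>
  that represents \<open>f\<close> near all of its points (\<open>stem_rep_connected\<close>). A sphere of radius \<open>0\<close> is a single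
  real point, where nothing has to be propagated.

  It remains to expand \<open>\<alpha> + i \<beta>\<close>, whose four coordinates are complex holomorphic functions. Near
  \<open>x0 + \<bar>y0\<bar> i\<close> every holomorphic function \<open>F\<close> (real on the real axis if \<open>y0 = 0\<close>) has the form
  \<open>F z = G0 (P z) + z G1 (P z)\<close> with \<open>P z = (z - x0)\<^sup>2 + y0\<^sup>2\<close> and power series \<open>G0\<close>, \<open>G1\<close> with real
  coefficients (\<open>spherical_expansion\<close>). As the coefficients are real, \<open>i\<close> may be replaced by any
  \<open>L \<in> \<S>\<close>, which gives the series for \<open>f\<close> (\<open>stem_expansion\<close>).
\<close>

section \<open>Imaginary units\<close>

lemma of_real_quat: "of_real r = Quat r 0 0 0"
  by (simp add: of_real_def scaleR_quat_def one_quat_def)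

lemma imag_units_iff:
  "L \<in> \<S> \<longleftrightarrow> qre L = 0 \<and> (qi L)\<^sup>2 + (qj L)\<^sup>2 + (qk L)\<^sup>2 = 1"
proof
  assume "L \<in> \<S>"
  then have e: "qre L * qre L - qi L * qi L - qj L * qj L - qk L * qk L = -1"
    "qre L * qi L = 0" "qre L * qj L = 0" "qre L * qk L = 0"
    by (auto simp: imag_units_def power2_eq_square times_quat_def one_quat_def uminus_quat_def)
  have "qre L = 0"
  proof (rule ccontr)
    assume "qre L \<noteq> 0"
    then have "qre L * qre L = -1" using e by simp
    moreover have "qre L * qre L \<ge> 0" by simp
    ultimately show False by linarith
  qed
  with e show "qre L = 0 \<and> (qi L)\<^sup>2 + (qj L)\<^sup>2 + (qk L)\<^sup>2 = 1"
    by (simp add: power2_eq_square)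
qed (simp add: imag_units_def power2_eq_square times_quat_def one_quat_def uminus_quat_def)

lemma imag_unit_square: "L \<in> \<S> \<Longrightarrow> L * L = -1"
  by (simp add: imag_units_def power2_eq_square)

lemma imag_unit_square_left: "L \<in> \<S> \<Longrightarrow> L * (L * q) = - q"
  by (simp flip: mult.assoc add: imag_unit_square)

lemma norm_imag_unit: "L \<in> \<S> \<Longrightarrow> norm L = 1"
  by (simp add: imag_units_iff norm_quat_def)

text \<open>
  Conjugating \<open>I\<close> by \<open>1 + s m\<close> for some \<open>m\<close> that does not commute with \<open>I\<close> yields imaginary units that
  tend to \<open>I\<close> as \<open>s\<close> tends to \<open>0\<close> and differ from it.
\<close>

lemma imag_unit_not_isolated:
  assumes I: "I \<in> \<S>" and "e > 0"
  obtains K where "K \<in> \<S>" "K \<noteq> I" "dist K I < e"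
proof -
  have "\<exists>m. m * I \<noteq> I * m"
  proof (rule ccontr)
    assume "\<nexists>m. m * I \<noteq> I * m"
    then have "Quat 0 1 0 0 * I = I * Quat 0 1 0 0" "Quat 0 0 1 0 * I = I * Quat 0 0 1 0"
      by blast+
    then show False using I by (simp add: times_quat_def imag_units_iff)
  qed
  then obtain m where m: "m * I \<noteq> I * m" by blast
  define u where "u s = 1 + s *\<^sub>R m" for s
  define K where "K s = u s * I * inverse (u s)" for s
  have u0: "u \<midarrow>0\<rightarrow> 1"
    unfolding u_def [abs_def] by (rule tendsto_eq_intros | simp)+
  have "K \<midarrow>0\<rightarrow> 1 * I * inverse 1"
    unfolding K_def by (intro tendsto_intros u0) simp
  then have "\<forall>\<^sub>F s in at 0. dist (K s) I < e"
    using \<open>e > 0\<close> by (simp add: tendsto_iff)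
  moreover have "\<forall>\<^sub>F s in at 0. u s \<noteq> 0"
    using u0 by (rule tendsto_imp_eventually_ne) simp
  moreover have "\<forall>\<^sub>F s in at (0::real). s \<noteq> 0"
    by (rule eventually_neq_at_within)
  ultimately have "\<forall>\<^sub>F s in at 0. dist (K s) I < e \<and> u s \<noteq> 0 \<and> s \<noteq> 0"
    by eventually_elim auto
  then obtain s where s: "dist (K s) I < e" "u s \<noteq> 0" "s \<noteq> 0"
    using eventually_happens' [OF at_neq_bot] by blast
  have Ku: "K s * u s = u s * I"
    using s(2) by (simp add: K_def mult.assoc)
  have "K s * K s = K s * u s * I * inverse (u s)"
    by (simp add: K_def mult.assoc)
  also have "\<dots> = - 1"
    unfolding Ku using s(2) by (simp add: imag_unit_square [OF I] mult.assoc imag_unit_square_left [OF I])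
  finally have "K s \<in> \<S>" by (simp add: imag_units_def power2_eq_square)
  moreover have "K s \<noteq> I"
  proof
    assume "K s = I"
    with Ku have "s *\<^sub>R (m * I) = s *\<^sub>R (I * m)" by (auto simp: u_def algebra_simps)
    with s(3) m show False by (metis scaleR_cancel_left)
  qed
  ultimately show ?thesis using that s(1) by blast
qed

section \<open>Coordinates on the slices\<close>

text \<open>
  For \<open>L \<in> \<S>\<close> this is the embedding \<open>x + y i \<mapsto> x + y L\<close> of the complex numbers onto the slice of \<open>L\<close>,
  a homomorphism of real algebras; the definition makes sense for every quaternion \<open>L\<close>.
\<close>

definition slice_emb :: "quat \<Rightarrow> complex \<Rightarrow> quat" where
  "slice_emb L z = of_real (Re z) + of_real (Im z) * L"

lemma slice_emb_of_real [simp]: "slice_emb L (of_real x) = of_real x"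
  by (simp add: slice_emb_def)

lemma slice_emb_add: "slice_emb L (z + w) = slice_emb L z + slice_emb L w"
  by (simp add: slice_emb_def algebra_simps)

lemma slice_emb_mult:
  assumes "L \<in> \<S>" shows "slice_emb L (z * w) = slice_emb L z * slice_emb L w"
proof -
  have "slice_emb L z * slice_emb L w = of_real (Re z * Re w) + of_real (Re z * Im w) * L
      + of_real (Im z * Re w) * L + of_real (Im z * Im w) * (L * L)"
    by (simp add: slice_emb_def of_real_def algebra_simps)
  also have "\<dots> = slice_emb L (z * w)"
    by (simp add: imag_unit_square [OF assms] slice_emb_def algebra_simps)
  finally show ?thesis ..
qed

lemma slice_emb_power: "L \<in> \<S> \<Longrightarrow> slice_emb L (z ^ n) = slice_emb L z ^ n"
proof (induction n)
  case 0 then show ?case by (simp add: slice_emb_def)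
next
  case (Suc n) then show ?case by (simp add: slice_emb_mult)
qed

lemma bounded_linear_slice_emb: "bounded_linear (slice_emb L)"
proof -
  have "bounded_linear (\<lambda>z. Re z *\<^sub>R (1::quat) + Im z *\<^sub>R L)"
    by (intro bounded_linear_add bounded_linear_scaleR_const bounded_linear_Re bounded_linear_Im)
  then show ?thesis by (simp add: slice_emb_def [abs_def] of_real_def)
qed

lemma continuous_on_slice_emb [continuous_intros]:
  assumes "continuous_on A f" "continuous_on A g"
  shows "continuous_on A (\<lambda>x. slice_emb (f x) (g x))"
  unfolding slice_emb_def using assms by (intro continuous_intros)

lemma bounded_linear_qre: "bounded_linear qre"
proof -
  have "bounded_linear (\<lambda>q::quat. inner q 1)" by (rule bounded_linear_inner_left)
  moreover have "(\<lambda>q::quat. inner q 1) = qre"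
    by (simp add: inner_quat_def one_quat_def fun_eq_iff)
  ultimately show ?thesis by simp
qed

lemmas continuous_on_qre [continuous_intros] =
  bounded_linear.continuous_on [OF bounded_linear_qre]

lemma norm_slice_emb:
  assumes "L \<in> \<S>" shows "norm (slice_emb L z) = norm z"
proof -
  have "qre L = 0" using assms by (simp add: imag_units_iff)
  then have "(norm (slice_emb L z))\<^sup>2 = (Re z)\<^sup>2 + (Im z)\<^sup>2 * ((qi L)\<^sup>2 + (qj L)\<^sup>2 + (qk L)\<^sup>2)"
    by (simp add: norm_quat_def slice_emb_def of_real_quat plus_quat_def times_quat_def
        power_mult_distrib algebra_simps)
  also have "\<dots> = (norm z)\<^sup>2"
    using assms unfolding imag_units_iff by (simp only: cmod_power2 mult_1_right)
  finally show ?thesis by simp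
qed

text \<open>
  The point \<open>x + y i\<close> with \<open>y \<ge> 0\<close> such that the quaternion equals \<open>x + y L\<close> for some \<open>L \<in> \<S>\<close>.
  Unlike the unit \<open>L\<close>, which is arbitrary at real points, it is unique and depends continuously on
  the quaternion.
\<close>

definition half_plane_coord :: "quat \<Rightarrow> complex" where
  "half_plane_coord q = Complex (qre q) (norm (q - of_real (qre q)))"

lemma continuous_on_half_plane_coord: "continuous_on A half_plane_coord"
proof -
  have eq: "half_plane_coord = (\<lambda>q. of_real (qre q) + \<i> * of_real (norm (q - of_real (qre q))))"
    by (simp add: half_plane_coord_def fun_eq_iff complex_eq_iff)
  show ?thesis unfolding eq by (intro continuous_intros)
qed

lemma eventually_half_plane_coord:
  assumes "open N" "half_plane_coord p \<in> N"
  shows "\<forall>\<^sub>F q in nhds p. half_plane_coord q \<in> N"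
proof -
  have "open (half_plane_coord -` N)"
    using assms(1) by (intro open_vimage continuous_on_half_plane_coord)
  then show ?thesis
    unfolding eventually_nhds using assms(2) by blast
qed

lemma qre_slice_emb: "L \<in> \<S> \<Longrightarrow> qre (slice_emb L z) = Re z"
  by (simp add: slice_emb_def of_real_quat plus_quat_def times_quat_def imag_units_iff)

lemma slice_emb_minus_Re: "slice_emb L z - of_real (Re z) = of_real (Im z) * L"
  by (simp add: slice_emb_def)

lemma half_plane_coord_slice_emb: "L \<in> \<S> \<Longrightarrow> half_plane_coord (slice_emb L z) = Complex (Re z) \<bar>Im z\<bar>"
  by (simp add: half_plane_coord_def qre_slice_emb slice_emb_minus_Re norm_mult norm_imag_unit)

lemma half_plane_coord_sphere:
  assumes "q \<in> quat_sphere x y" shows "half_plane_coord q = Complex x \<bar>y\<bar>"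
proof -
  obtain L where L: "L \<in> \<S>" "q = slice_emb L (Complex x y)"
    using assms by (auto simp: quat_sphere_def slice_emb_def)
  show ?thesis unfolding L(2) using half_plane_coord_slice_emb [OF L(1), of "Complex x y"] by simp
qed

lemma slice_emb_half_plane_coord: "\<exists>L\<in>\<S>. slice_emb L (half_plane_coord q) = q"
proof (cases "q = of_real (qre q)")
  case True
  have "Quat 0 1 0 0 \<in> \<S>" by (simp add: imag_units_iff)
  moreover have "slice_emb (Quat 0 1 0 0) (half_plane_coord q) = q"
    using True by (simp add: slice_emb_def half_plane_coord_def)
  ultimately show ?thesis by blast
next
  case False
  define m where "m = norm (q - of_real (qre q))"
  have "m > 0"
    using False by (simp add: m_def)
  moreover have "m\<^sup>2 = (qi q)\<^sup>2 + (qj q)\<^sup>2 + (qk q)\<^sup>2"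
    by (simp add: m_def norm_quat_def of_real_quat minus_quat_def)
  ultimately have m: "m > 0" "m\<^sup>2 = (qi q)\<^sup>2 + (qj q)\<^sup>2 + (qk q)\<^sup>2" .
  define L where "L = (q - of_real (qre q)) /\<^sub>R m"
  have "L \<in> \<S>"
    using m(1) by (simp add: L_def imag_units_iff of_real_quat minus_quat_def scaleR_quat_def
        power_mult_distrib power_inverse flip: distrib_left m(2))
  moreover have "slice_emb L (half_plane_coord q) = q"
    using m(1) by (simp add: slice_emb_def half_plane_coord_def flip: m_def)
      (simp add: L_def flip: scaleR_conv_of_real)
  ultimately show ?thesis by blast
qed

section \<open>Holomorphy on slices and the identity theorem\<close>

text \<open>
  The continuity of the partial derivatives makes \<open>f\<close> real differentiable along the slice of \<open>L\<close>, and
  the Cauchy-Riemann equation says that the differential intertwines multiplication by \<open>i\<close> with left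
  multiplication by \<open>L\<close>. This form of the equation is the one used from here on.
\<close>

lemma slice_regular_has_derivative:
  assumes "open \<Omega>" "slice_regular_on \<Omega> f" "L \<in> \<S>" "slice_emb L z \<in> \<Omega>"
  shows "\<exists>D. ((\<lambda>z. f (slice_emb L z)) has_derivative D) (at z) \<and> (\<forall>w. D (\<i> * w) = L * D w)"
proof -
  define S where "S = {(x, y). of_real x + of_real y * L \<in> \<Omega>}"
  obtain fx fy where cy: "continuous_on S fy" and
    D: "\<And>x y. (x, y) \<in> S \<Longrightarrow>
             ((\<lambda>s. f (of_real s + of_real y * L)) has_vector_derivative fx (x, y)) (at x) \<and>
             ((\<lambda>t. f (of_real x + of_real t * L)) has_vector_derivative fy (x, y)) (at y) \<and>
             (1 / 2) *\<^sub>R (fx (x, y) + L * fy (x, y)) = 0"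
    using assms(2,3) unfolding slice_regular_on_def Let_def S_def by fast
  obtain x y where z: "z = Complex x y" by (cases z)
  have S_vim: "S = (\<lambda>p. of_real (fst p) + of_real (snd p) * L) -` \<Omega>"
    by (auto simp: S_def)
  have "open S"
    unfolding S_vim by (intro open_vimage assms continuous_intros)
  moreover have xyS: "(x, y) \<in> S"
    using assms(4) by (simp add: S_def slice_emb_def z)
  ultimately obtain X Y where X: "open X" "x \<in> X" and Y: "open Y" "y \<in> Y" and XY: "X \<times> Y \<subseteq> S"
    by (metis open_prod_elim mem_Sigma_iff)
  obtain e where e: "e > 0" "ball y e \<subseteq> Y" using Y openE by blast
  have XB: "X \<times> ball y e \<subseteq> S" using XY e by auto
  have "((\<lambda>(x, y). f (of_real x + of_real y * L)) has_derivative
      (\<lambda>(tx, ty). tx *\<^sub>R fx (x, y) + blinfun_scaleR_left (fy (x, y)) ty)) (at (x, y) within X \<times> ball y e)"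
  proof (rule has_derivative_partialsI)
    show "((\<lambda>x. f (of_real x + of_real y * L)) has_derivative (\<lambda>tx. tx *\<^sub>R fx (x, y))) (at x within X)"
      using D [OF xyS] by (auto simp: has_vector_derivative_def intro: has_derivative_at_withinI)
    show "((\<lambda>y. f (of_real x' + of_real y * L)) has_derivative blinfun_scaleR_left (fy (x', y')))
        (at y' within ball y e)" if "x' \<in> X" "y' \<in> ball y e" for x' y'
    proof -
      have "(x', y') \<in> S" using that XB by auto
      then show ?thesis
        using D [of x' y'] by (auto simp: has_vector_derivative_def intro: has_derivative_at_withinI)
    qed
    have "continuous (at (x, y)) fy"
      using cy \<open>open S\<close> xyS by (simp add: continuous_on_eq_continuous_at)
    then show "continuous (at (x, y) within X \<times> ball y e) (\<lambda>(x, y). blinfun_scaleR_left (fy (x, y)))"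
      by (auto intro!: continuous_intros bounded_linear.continuous [OF bounded_linear_blinfun_scaleR_left]
          simp: continuous_at_imp_continuous_within case_prod_unfold)
  qed (use e in auto)
  moreover have "at (x, y) within X \<times> ball y e = at (x, y)"
    using X e by (intro at_within_open open_Times) auto
  ultimately have "((\<lambda>(x, y). f (of_real x + of_real y * L)) has_derivative
      (\<lambda>(tx, ty). tx *\<^sub>R fx (x, y) + ty *\<^sub>R fy (x, y))) (at (Re z, Im z))"
    by (simp add: z)
  moreover have "((\<lambda>w. (Re w, Im w)) has_derivative (\<lambda>w. (Re w, Im w))) (at z)"
    by (intro bounded_linear_imp_has_derivative bounded_linear_Pair bounded_linear_Re bounded_linear_Im)
  ultimately have "((\<lambda>(x, y). f (of_real x + of_real y * L)) \<circ> (\<lambda>w. (Re w, Im w)) has_derivative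
      (\<lambda>(tx, ty). tx *\<^sub>R fx (x, y) + ty *\<^sub>R fy (x, y)) \<circ> (\<lambda>w. (Re w, Im w))) (at z)"
    by (intro diff_chain_at)
  then have deriv: "((\<lambda>w. f (slice_emb L w)) has_derivative
      (\<lambda>w. Re w *\<^sub>R fx (x, y) + Im w *\<^sub>R fy (x, y))) (at z)"
    by (simp add: o_def slice_emb_def)
  have fx: "fx (x, y) = - (L * fy (x, y))"
    using D [OF xyS] by (simp add: eq_neg_iff_add_eq_0)
  have "\<forall>w. Re (\<i> * w) *\<^sub>R fx (x, y) + Im (\<i> * w) *\<^sub>R fy (x, y)
     = L * (Re w *\<^sub>R fx (x, y) + Im w *\<^sub>R fy (x, y))"
    by (simp add: fx imag_unit_square_left [OF assms(3)] algebra_simps)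
  with deriv show ?thesis by blast
qed

lemma holomorphic_on_complex_linear_derivative:
  assumes "open N"
    and "\<And>z. z \<in> N \<Longrightarrow> \<exists>D. (f has_derivative D) (at z) \<and> (\<forall>w. D (\<i> * w) = \<i> * D w)"
  shows "f holomorphic_on N"
proof (clarsimp simp: holomorphic_on_open [OF assms(1)])
  fix z assume "z \<in> N"
  then obtain D where D: "(f has_derivative D) (at z)" "\<And>w. D (\<i> * w) = \<i> * D w"
    using assms(2) by blast
  interpret D: bounded_linear D using D(1) by (rule has_derivative_bounded_linear)
  have "D w = D 1 * w" for w
  proof -
    have "D w = D (Re w *\<^sub>R 1 + \<i> * (Im w *\<^sub>R 1))"
      by (intro arg_cong [of _ _ D]) (simp add: complex_eq_iff)
    also have "\<dots> = Re w *\<^sub>R D 1 + \<i> * (Im w *\<^sub>R D 1)"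
      by (simp only: D.add D.scaleR D(2))
    also have "\<dots> = D 1 * w"
      by (simp add: complex_eq_iff algebra_simps)
    finally show ?thesis .
  qed
  then have "D = (*) (D 1)" by blast
  with D(1) have "(f has_derivative (*) (D 1)) (at z)" by metis
  then show "\<exists>f'. (f has_field_derivative f') (at z)"
    by (auto simp: has_field_derivative_def)
qed

lemma islimpt_Reals:
  assumes "open N" "complex_of_real t \<in> N"
  shows "of_real t islimpt N \<inter> \<real>"
  unfolding islimpt_approachable
proof (intro allI impI)
  fix e :: real assume "e > 0"
  obtain r where r: "r > 0" "ball (of_real t) r \<subseteq> N" using assms openE by blast
  define s where "s = min e r / 2"
  have s: "0 < s" "s < e" "s < r" using \<open>e > 0\<close> r(1) by (auto simp: s_def min_def)
  have *: "dist (complex_of_real (t + s)) (of_real t) = s"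
    using s by (simp add: dist_norm)
  then have "of_real (t + s) \<in> ball (complex_of_real t) r"
    using s by (simp add: dist_commute)
  then have "of_real (t + s) \<in> N \<inter> \<real>" using r(2) by (blast intro: Reals_of_real)
  then show "\<exists>x'\<in>N \<inter> \<real>. x' \<noteq> complex_of_real t \<and> dist x' (complex_of_real t) < e"
    using * s by (metis dist_eq_0_iff less_irrefl)
qed

lemma inner_imag_unit_mult_right: "L \<in> \<S> \<Longrightarrow> inner u (L * v) = - inner (L * u) v"
  by (simp add: imag_units_iff inner_quat_def times_quat_def algebra_simps)

text \<open>
  The identity theorem for functions that are holomorphic with respect to left multiplication by \<open>L\<close>.
  It reduces to the complex one: left multiplication by \<open>L\<close> is skew-adjoint, so for each quaternion
  \<open>u\<close> the function \<open>\<langle>u, h\<rangle> + i \<langle>L u, h\<rangle>\<close> is holomorphic.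
\<close>

lemma slice_holomorphic_eq_0:
  assumes L: "L \<in> \<S>" and N: "open N" "connected N" and t: "of_real t \<in> N"
    and D: "\<And>z. z \<in> N \<Longrightarrow> \<exists>D. (h has_derivative D) (at z) \<and> (\<forall>w. D (\<i> * w) = L * D w)"
    and 0: "\<And>x. of_real x \<in> N \<Longrightarrow> h (of_real x) = 0"
    and z: "z \<in> N"
  shows "h z = (0::quat)"
proof -
  define \<phi> where
    "\<phi> u z = complex_of_real (inner u (h z)) + \<i> * of_real (inner (L * u) (h z))" for u z
  have "\<phi> u z = 0" for u
  proof (rule analytic_continuation [OF _ N _ t islimpt_Reals [OF N(1) t] _ z])
    show "\<phi> u holomorphic_on N"
    proof (rule holomorphic_on_complex_linear_derivative [OF N(1)])
      fix z assume "z \<in> N"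
      then obtain D where D: "(h has_derivative D) (at z)" "\<And>w. D (\<i> * w) = L * D w"
        using D by blast
      define D' where
        "D' w = complex_of_real (inner u (D w)) + \<i> * of_real (inner (L * u) (D w))" for w
      have "(\<phi> u has_derivative D') (at z)"
        unfolding \<phi>_def [abs_def] D'_def [abs_def] using D(1)
        by (intro derivative_intros) auto
      moreover have "D' (\<i> * w) = \<i> * D' w" for w
        by (simp add: D'_def D(2) inner_imag_unit_mult_right [OF L]
            imag_unit_square_left [OF L] algebra_simps)
      ultimately show "\<exists>D. (\<phi> u has_derivative D) (at z) \<and> (\<forall>w. D (\<i> * w) = \<i> * D w)"
        by blast
    qed
    show "\<phi> u w = 0" if "w \<in> N \<inter> \<real>" for w
      using that 0 by (auto simp: \<phi>_def elim!: Reals_cases)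
  qed auto
  then have "Re (\<phi> (h z) z) = 0" by simp
  then have "inner (h z) (h z) = 0" by (simp add: \<phi>_def)
  then show ?thesis by simp
qed

section \<open>Stem functions along a slice\<close>

text \<open>
  The Cauchy-Riemann equations for the pair \<open>(\<alpha>, \<beta>)\<close>, i.e. holomorphy of \<open>\<alpha> + i \<beta>\<close> with values in the
  complexification of the quaternions. The two equations for the differentials are stated separately
  although each implies the other. The symmetry \<open>\<alpha>(cnj z) = \<alpha>(z)\<close>, \<open>\<beta>(cnj z) = - \<beta>(z)\<close> of a stem function
  is not included, as \<open>N\<close> need not be symmetric about the real axis.
\<close>

definition stem_on :: "complex set \<Rightarrow> (complex \<Rightarrow> quat) \<Rightarrow> (complex \<Rightarrow> quat) \<Rightarrow> bool" where
  "stem_on N \<alpha> \<beta> \<longleftrightarrow> (\<forall>z\<in>N. \<exists>A B. (\<alpha> has_derivative A) (at z) \<and> (\<beta> has_derivative B) (at z) \<and>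
     (\<forall>w. A (\<i> * w) = - B w \<and> B (\<i> * w) = A w))"

lemma affine_coefficients_unique:
  assumes "a + J * b = a' + J * b'" "a + K * b = a' + K * b'" "J \<noteq> (K::quat)"
  shows "a = a' \<and> b = b'"
proof -
  have "(J - K) * (b - b') = (a + J * b) - (a + K * b) - ((a' + J * b') - (a' + K * b'))"
    by (simp add: algebra_simps)
  then have "b = b'" using assms by simp
  then show ?thesis using assms by simp
qed

text \<open>
  The two slices of \<open>J\<close> and \<open>K\<close> determine \<open>\<alpha>\<close> and \<open>\<beta>\<close> by linear algebra, and the Cauchy-Riemann
  equations for \<open>f\<close> on these slices turn into those for \<open>(\<alpha>, \<beta>)\<close>. On any further slice \<open>f\<close> and
  \<open>\<alpha> + L \<beta>\<close> are both holomorphic, and they agree at the real points, where \<open>\<beta>\<close> vanishes because \<open>f\<close>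
  takes a single value; hence they agree on all of \<open>N\<close>.
\<close>

lemma stem_exists:
  assumes \<Omega>: "open \<Omega>" and f: "slice_regular_on \<Omega> f"
    and W: "W \<subseteq> \<S>" "J \<in> W" "K \<in> W" "J \<noteq> K"
    and N: "open N" "connected N" "of_real t \<in> N"
    and sub: "\<And>z L. z \<in> N \<Longrightarrow> L \<in> W \<Longrightarrow> slice_emb L z \<in> \<Omega>"
  obtains \<alpha> \<beta> where "stem_on N \<alpha> \<beta>"
    "\<And>z L. z \<in> N \<Longrightarrow> L \<in> W \<Longrightarrow> f (slice_emb L z) = \<alpha> z + L * \<beta> z"
proof
  define c where "c = inverse (J - K)"
  define \<beta> where "\<beta> z = c * (f (slice_emb J z) - f (slice_emb K z))" for z
  define \<alpha> where "\<alpha> z = f (slice_emb J z) - J * \<beta> z" for z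
  have c: "(J - K) * c = 1" using W by (simp add: c_def)
  have "\<alpha> z + K * \<beta> z = f (slice_emb J z) - (J - K) * \<beta> z" for z
    by (simp add: \<alpha>_def algebra_simps)
  moreover have "(J - K) * \<beta> z = f (slice_emb J z) - f (slice_emb K z)" for z
    by (simp add: \<beta>_def c flip: mult.assoc)
  ultimately have fK: "f (slice_emb K z) = \<alpha> z + K * \<beta> z" for z by simp
  have fJ: "f (slice_emb J z) = \<alpha> z + J * \<beta> z" for z by (simp add: \<alpha>_def)
  have real: "\<beta> (of_real x) = 0" "\<alpha> (of_real x) = f (of_real x)" for x
    by (simp_all add: \<alpha>_def \<beta>_def)
  have deriv: "\<exists>A B. (\<alpha> has_derivative A) (at z) \<and> (\<beta> has_derivative B) (at z) \<and>
     (\<forall>w. A (\<i> * w) = - B w \<and> B (\<i> * w) = A w)" if z: "z \<in> N" for z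
  proof -
    from slice_regular_has_derivative [OF \<Omega> f _ sub [OF z W(2)]] W obtain P where
      P: "((\<lambda>z. f (slice_emb J z)) has_derivative P) (at z)" "\<And>w. P (\<i> * w) = J * P w" by blast
    from slice_regular_has_derivative [OF \<Omega> f _ sub [OF z W(3)]] W obtain Q where
      Q: "((\<lambda>z. f (slice_emb K z)) has_derivative Q) (at z)" "\<And>w. Q (\<i> * w) = K * Q w" by blast
    define B where "B w = c * (P w - Q w)" for w
    define A where "A w = P w - J * B w" for w
    have \<beta>': "(\<beta> has_derivative B) (at z)"
      unfolding \<beta>_def [abs_def] B_def [abs_def] using P(1) Q(1) by (intro derivative_intros)
    have \<alpha>': "(\<alpha> has_derivative A) (at z)"
      unfolding \<alpha>_def [abs_def] A_def [abs_def] using P(1) \<beta>' by (intro derivative_intros)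
    have PA: "P w = A w + J * B w" for w by (simp add: A_def)
    have "(J - K) * B w = P w - Q w" for w
      by (simp add: B_def c flip: mult.assoc)
    then have QA: "Q w = A w + K * B w" for w
      by (simp add: A_def algebra_simps)
    have "A (\<i> * w) + J * B (\<i> * w) = - B w + J * A w"
      "A (\<i> * w) + K * B (\<i> * w) = - B w + K * A w" for w
      using P(2) [of w] Q(2) [of w] W imag_unit_square_left
      unfolding PA QA by (auto simp: algebra_simps)
    from affine_coefficients_unique [OF this W(4)]
    show ?thesis using \<alpha>' \<beta>' by blast
  qed
  then show "stem_on N \<alpha> \<beta>" by (simp add: stem_on_def)
  fix z L assume z: "z \<in> N" and "L \<in> W"
  then have L: "L \<in> \<S>" using W by blast
  have "f (slice_emb L z) - (\<alpha> z + L * \<beta> z) = 0"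
  proof (rule slice_holomorphic_eq_0 [OF L N _ _ z])
    fix z assume z: "z \<in> N"
    from slice_regular_has_derivative [OF \<Omega> f L sub [OF z \<open>L \<in> W\<close>]] obtain P where
      P: "((\<lambda>z. f (slice_emb L z)) has_derivative P) (at z)" "\<And>w. P (\<i> * w) = L * P w" by blast
    obtain A B where AB: "(\<alpha> has_derivative A) (at z)" "(\<beta> has_derivative B) (at z)"
      "\<And>w. A (\<i> * w) = - B w \<and> B (\<i> * w) = A w"
      using deriv [OF z] by blast
    have "((\<lambda>z. f (slice_emb L z) - (\<alpha> z + L * \<beta> z)) has_derivative (\<lambda>w. P w - (A w + L * B w))) (at z)"
      using P(1) AB(1,2) by (intro derivative_intros)
    moreover have "P (\<i> * w) - (A (\<i> * w) + L * B (\<i> * w)) = L * (P w - (A w + L * B w))" for w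
      by (simp add: P(2) AB(3) algebra_simps imag_unit_square_left [OF L])
    ultimately show "\<exists>D. ((\<lambda>z. f (slice_emb L z) - (\<alpha> z + L * \<beta> z)) has_derivative D) (at z) \<and>
        (\<forall>w. D (\<i> * w) = L * D w)"
      by blast
  qed (simp add: real)
  then show "f (slice_emb L z) = \<alpha> z + L * \<beta> z" by simp
qed

lemma slice_domain_open_connected_slice:
  assumes "slice_domain \<Omega>" "I \<in> \<S>"
  shows "open {z. slice_emb I z \<in> \<Omega>}" "connected {z. slice_emb I z \<in> \<Omega>}"
proof -
  have "open (slice_emb I -` \<Omega>)"
    using assms(1) by (intro open_vimage continuous_intros) (auto simp: slice_domain_def)
  then show "open {z. slice_emb I z \<in> \<Omega>}" by (simp add: vimage_def)
  \<comment> \<open>A continuous left inverse of the embedding of the slice.\<close>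
  define g where "g q = of_real (qre q) + \<i> * of_real (inner I q)" for q
  have g: "g (slice_emb I z) = z" for z
    using assms(2)
    by (simp add: g_def complex_eq_iff slice_emb_def of_real_quat plus_quat_def times_quat_def
        inner_quat_def imag_units_iff power2_eq_square) algebra
  have "{z. slice_emb I z \<in> \<Omega>} = g ` (\<Omega> \<inter> quat_slice I)"
  proof (intro subset_antisym subsetI)
    fix z assume "z \<in> {z. slice_emb I z \<in> \<Omega>}"
    then have "slice_emb I z \<in> \<Omega> \<inter> quat_slice I" by (auto simp: quat_slice_def slice_emb_def)
    then show "z \<in> g ` (\<Omega> \<inter> quat_slice I)" by (intro image_eqI) (simp_all add: g)
  next
    fix z assume "z \<in> g ` (\<Omega> \<inter> quat_slice I)"
    then obtain x y where "z = g (of_real x + of_real y * I)" "of_real x + of_real y * I \<in> \<Omega>"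
      by (auto simp: quat_slice_def)
    moreover have "of_real x + of_real y * I = slice_emb I (Complex x y)" by (simp add: slice_emb_def)
    ultimately show "z \<in> {z. slice_emb I z \<in> \<Omega>}" by (simp add: g)
  qed
  moreover have "continuous_on A g" for A
    unfolding g_def by (intro continuous_intros)
  ultimately show "connected {z. slice_emb I z \<in> \<Omega>}"
    using assms by (auto simp: slice_domain_def intro!: connected_continuous_image)
qed

text \<open>
  A point of \<open>\<Omega>\<close> is joined to a real point by a path in its slice. As the path is compact, a
  neighborhood \<open>N\<close> of it, copied into any slice close to the given one, still lies in \<open>\<Omega>\<close>.
\<close>

lemma slice_tube:
  assumes \<Omega>: "slice_domain \<Omega>" and I: "I \<in> \<S>" and z0: "slice_emb I z0 \<in> \<Omega>"
  obtains N t e where "open N" "connected N" "z0 \<in> N" "of_real t \<in> N" "e > 0"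
    "\<And>z L. z \<in> N \<Longrightarrow> dist L I < e \<Longrightarrow> slice_emb L z \<in> \<Omega>"
proof -
  define D where "D = {z. slice_emb I z \<in> \<Omega>}"
  obtain t where t: "of_real t \<in> \<Omega>" using \<Omega> by (auto simp: slice_domain_def Reals_def)
  have "path_connected D"
    using slice_domain_open_connected_slice [OF \<Omega> I] by (simp add: D_def connected_open_path_connected)
  moreover have "z0 \<in> D" "of_real t \<in> D" using z0 t by (simp_all add: D_def)
  ultimately obtain \<gamma> where \<gamma>: "path \<gamma>" "path_image \<gamma> \<subseteq> D" "pathstart \<gamma> = z0" "pathfinish \<gamma> = of_real t"
    unfolding path_connected_def by blast
  define T where "T = (\<lambda>p. slice_emb (fst p) (snd p)) -` \<Omega>"
  have "open T"
    unfolding T_def using \<Omega> by (intro open_vimage continuous_intros) (auto simp: slice_domain_def)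
  moreover have "compact ({I} \<times> path_image \<gamma>)"
    using \<gamma> by (intro compact_Times compact_path_image) auto
  moreover have "{I} \<times> path_image \<gamma> \<subseteq> T"
    using \<gamma>(2) by (auto simp: T_def D_def)
  ultimately obtain e where e: "e > 0" "(\<Union>x\<in>{I} \<times> path_image \<gamma>. ball x e) \<subseteq> T"
    using compact_subset_open_imp_ball_epsilon_subset by metis
  \<comment> \<open>The thickened path is written as a sum of sets to see that it is both open and connected.\<close>
  define N where "N = (\<Union>x\<in>path_image \<gamma>. \<Union>y\<in>ball 0 (e / 2). {x + y})"
  have N_image: "N = (\<lambda>p. fst p + snd p) ` (path_image \<gamma> \<times> ball 0 (e / 2))"
  proof (intro equalityI subsetI)
    fix z assume "z \<in> N"
    then obtain x y where "x \<in> path_image \<gamma>" "y \<in> ball 0 (e / 2)" "z = x + y"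
      unfolding N_def by blast
    then show "z \<in> (\<lambda>p. fst p + snd p) ` (path_image \<gamma> \<times> ball 0 (e / 2))"
      by (intro image_eqI [of _ _ "(x, y)"]) simp_all
  next
    fix z assume "z \<in> (\<lambda>p. fst p + snd p) ` (path_image \<gamma> \<times> ball 0 (e / 2))"
    then obtain p where p: "z = fst p + snd p" "p \<in> path_image \<gamma> \<times> ball 0 (e / 2)"
      by (rule imageE)
    from p(2) have "fst p \<in> path_image \<gamma>" "snd p \<in> ball 0 (e / 2)"
      by (simp_all only: mem_Times_iff)
    then show "z \<in> N" unfolding N_def p(1) by blast
  qed
  have "path_image \<gamma> \<subseteq> N"
  proof
    fix z assume "z \<in> path_image \<gamma>"
    moreover have "0 \<in> ball (0::complex) (e / 2)" using e(1) by simp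
    moreover have "z = z + 0" by simp
    ultimately show "z \<in> N" unfolding N_def by blast
  qed
  show ?thesis
  proof
    show "open N" unfolding N_def by (intro open_sums) auto
    show "connected N"
      unfolding N_image using \<gamma>
      by (intro connected_continuous_image continuous_intros connected_Times connected_path_image) auto
    show "z0 \<in> N" "of_real t \<in> N"
      using \<open>path_image \<gamma> \<subseteq> N\<close> \<gamma>(3,4) pathstart_in_path_image pathfinish_in_path_image by (metis subsetD)+
    show "e / 2 > 0" using e(1) by simp
    fix z L assume "z \<in> N" and L: "dist L I < e / 2"
    then obtain x y where xy: "x \<in> path_image \<gamma>" "norm y < e / 2" "z = x + y"
      by (auto simp: N_def)
    have "dist (I, x) (L, z) \<le> dist I L + dist x z"
      by (simp add: dist_Pair_Pair sqrt_sum_squares_le_sum)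
    also have "\<dots> < e"
      using L xy by (simp add: dist_commute dist_norm)
    finally have "(L, z) \<in> T" using e(2) xy(1) by fastforce
    then show "slice_emb L z \<in> \<Omega>" by (simp add: T_def)
  qed
qed

section \<open>Local representation near a point\<close>

text \<open>
  The representation \<open>f = \<alpha> + L \<beta>\<close> at a single point \<open>q\<close>. At a nonreal \<open>q\<close> exactly one \<open>L\<close> qualifies; at a
  real \<open>q\<close> every \<open>L \<in> \<S>\<close> does, so that the condition forces \<open>\<beta>\<close> to vanish there.
\<close>

definition stem_rep :: "(quat \<Rightarrow> quat) \<Rightarrow> (complex \<Rightarrow> quat) \<Rightarrow> (complex \<Rightarrow> quat) \<Rightarrow> quat \<Rightarrow> bool" where
  "stem_rep f \<alpha> \<beta> q \<longleftrightarrow>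
     (\<forall>L\<in>\<S>. slice_emb L (half_plane_coord q) = q \<longrightarrow>
       f q = \<alpha> (half_plane_coord q) + L * \<beta> (half_plane_coord q))"

text \<open>
  Around a real point a ball serves all slices at once, so two opposite units can be used.
\<close>

lemma local_stem_real:
  assumes \<Omega>: "slice_domain \<Omega>" and f: "slice_regular_on \<Omega> f" and p: "p \<in> \<Omega>"
    and Im: "Im (half_plane_coord p) = 0"
  obtains N \<alpha> \<beta> where "open N" "half_plane_coord p \<in> N" "stem_on N \<alpha> \<beta>"
    "\<forall>x. of_real x \<in> N \<longrightarrow> \<beta> (of_real x) = 0" "\<forall>\<^sub>F q in nhds p. stem_rep f \<alpha> \<beta> q"
proof -
  define I where "I = Quat 0 1 0 0"
  have I: "I \<in> \<S>" "- I \<in> \<S>" "I \<noteq> - I"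
    by (simp_all add: I_def imag_units_iff uminus_quat_def)
  have z0: "half_plane_coord p = of_real (qre p)"
    using Im by (simp add: half_plane_coord_def complex_eq_iff)
  then have pre: "p = of_real (qre p)"
    using slice_emb_half_plane_coord [of p] by auto
  have "open \<Omega>" using \<Omega> by (simp add: slice_domain_def)
  then obtain e where e: "e > 0" "ball p e \<subseteq> \<Omega>" using p openE by blast
  define N where "N = ball (half_plane_coord p) e"
  have sub: "slice_emb L z \<in> \<Omega>" if "z \<in> N" "L \<in> \<S>" for z L
  proof -
    have "p - slice_emb L z = slice_emb L (half_plane_coord p - z)"
      using pre by (simp add: z0 linear_diff [OF bounded_linear.linear [OF bounded_linear_slice_emb]])
    then have "dist p (slice_emb L z) = dist (half_plane_coord p) z"
      using that(2) by (simp add: dist_norm norm_slice_emb)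
    then show ?thesis using that(1) e(2) by (auto simp: N_def)
  qed
  have N: "open N" "connected N" "of_real (qre p) \<in> N"
    using e(1) by (auto simp: N_def z0)
  from stem_exists [OF \<open>open \<Omega>\<close> f order_refl I N sub]
  obtain \<alpha> \<beta> where *: "stem_on N \<alpha> \<beta>"
    "\<And>z L. z \<in> N \<Longrightarrow> L \<in> \<S> \<Longrightarrow> f (slice_emb L z) = \<alpha> z + L * \<beta> z" by blast
  have "\<beta> (of_real x) = 0" if "of_real x \<in> N" for x
    using *(2) [OF that I(1)] *(2) [OF that I(2)] I(3)
      affine_coefficients_unique
        [of "\<alpha> (of_real x)" I "\<beta> (of_real x)" "f (of_real x)" 0 "- I"]
    by simp
  moreover have "\<forall>\<^sub>F q in nhds p. half_plane_coord q \<in> N"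
    by (rule eventually_half_plane_coord) (use N z0 in auto)
  then have "\<forall>\<^sub>F q in nhds p. stem_rep f \<alpha> \<beta> q"
    by eventually_elim (metis stem_rep_def *(2))
  ultimately show ?thesis using that * N z0 by metis
qed

lemma local_stem_nonreal:
  assumes \<Omega>: "slice_domain \<Omega>" and f: "slice_regular_on \<Omega> f" and p: "p \<in> \<Omega>"
    and Im: "Im (half_plane_coord p) \<noteq> 0"
  obtains N \<alpha> \<beta> where "open N" "half_plane_coord p \<in> N" "stem_on N \<alpha> \<beta>"
    "\<forall>\<^sub>F q in nhds p. stem_rep f \<alpha> \<beta> q"
proof -
  obtain I where I: "I \<in> \<S>" "slice_emb I (half_plane_coord p) = p" using slice_emb_half_plane_coord by blast
  obtain N t e where N: "open N" "connected N" "half_plane_coord p \<in> N" "of_real t \<in> N" and "e > 0"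
    and sub: "\<And>z L. z \<in> N \<Longrightarrow> dist L I < e \<Longrightarrow> slice_emb L z \<in> \<Omega>"
    using slice_tube [OF \<Omega> I(1)] p I(2) by metis
  obtain K where K: "K \<in> \<S>" "K \<noteq> I" "dist K I < e"
    using imag_unit_not_isolated [OF I(1) \<open>e > 0\<close>] by blast
  define W where "W = {L \<in> \<S>. dist L I < e}"
  have W: "W \<subseteq> \<S>" "I \<in> W" "K \<in> W" "I \<noteq> K" using I K \<open>e > 0\<close> by (auto simp: W_def)
  have "open \<Omega>" using \<Omega> by (simp add: slice_domain_def)
  from stem_exists [OF this f W N(1,2,4)] sub
  obtain \<alpha> \<beta> where *: "stem_on N \<alpha> \<beta>"
    "\<And>z L. z \<in> N \<Longrightarrow> L \<in> W \<Longrightarrow> f (slice_emb L z) = \<alpha> z + L * \<beta> z"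
    unfolding W_def by blast
  \<comment> \<open>Off the real axis, \<open>g q\<close> is the imaginary unit of the slice through \<open>q\<close>.\<close>
  define g where "g q = (q - of_real (qre q)) /\<^sub>R norm (q - of_real (qre q))" for q
  have g: "L = g q" if "L \<in> \<S>" "slice_emb L (half_plane_coord q) = q" "Im (half_plane_coord q) \<noteq> 0" for L q
  proof -
    have "q - of_real (qre q) = Im (half_plane_coord q) *\<^sub>R L"
      using slice_emb_minus_Re [of L "half_plane_coord q"] that(2) by (simp add: half_plane_coord_def of_real_def)
    moreover have "L = v /\<^sub>R r" if "v = r *\<^sub>R L" "r \<noteq> 0" for v r
      using that by simp
    ultimately show ?thesis
      using that(3) unfolding g_def half_plane_coord_def complex.sel by blast
  qed
  have "isCont g p"
    unfolding g_def [abs_def] using Im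
    by (intro continuous_intros bounded_linear.isCont [OF bounded_linear_qre]) (auto simp: half_plane_coord_def)
  moreover have "g p = I" using g [OF I Im] by simp
  ultimately have "\<forall>\<^sub>F q in nhds p. dist (g q) I < e"
    using \<open>e > 0\<close> by (metis isCont_def tendsto_at_iff_tendsto_nhds tendstoD)
  moreover have "\<forall>\<^sub>F q in nhds p. half_plane_coord q \<in> N \<inter> - {z. Im z = 0}"
    using N Im closed_halfspace_Im_eq [of 0]
    by (intro eventually_half_plane_coord open_Int) (auto simp: open_Compl)
  ultimately have "\<forall>\<^sub>F q in nhds p. stem_rep f \<alpha> \<beta> q"
  proof eventually_elim
    case (elim q)
    show ?case
      unfolding stem_rep_def
    proof (intro ballI impI)
      fix L assume L: "L \<in> \<S>" "slice_emb L (half_plane_coord q) = q"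
      with elim g have "L \<in> W" by (auto simp: W_def)
      with *(2) elim L show "f q = \<alpha> (half_plane_coord q) + L * \<beta> (half_plane_coord q)" by fastforce
    qed
  qed
  then show ?thesis using that N * by blast
qed

lemma local_stem:
  assumes "slice_domain \<Omega>" "slice_regular_on \<Omega> f" "p \<in> \<Omega>"
  obtains N \<alpha> \<beta> where "open N" "half_plane_coord p \<in> N" "stem_on N \<alpha> \<beta>"
    "Im (half_plane_coord p) = 0 \<longrightarrow> (\<forall>x. of_real x \<in> N \<longrightarrow> \<beta> (of_real x) = 0)"
    "\<forall>\<^sub>F q in nhds p. stem_rep f \<alpha> \<beta> q"
proof (cases "Im (half_plane_coord p) = 0")
  case True
  obtain N \<alpha> \<beta> where *: "open N" "half_plane_coord p \<in> N" "stem_on N \<alpha> \<beta>"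
    "\<forall>x. of_real x \<in> N \<longrightarrow> \<beta> (of_real x) = 0" "\<forall>\<^sub>F q in nhds p. stem_rep f \<alpha> \<beta> q"
    by (rule local_stem_real [OF assms True])
  show ?thesis by (rule that [OF *(1-3) _ *(5)]) (simp add: *(4))
next
  case False
  obtain N \<alpha> \<beta> where *: "open N" "half_plane_coord p \<in> N" "stem_on N \<alpha> \<beta>"
    "\<forall>\<^sub>F q in nhds p. stem_rep f \<alpha> \<beta> q"
    by (rule local_stem_nonreal [OF assms False])
  show ?thesis by (rule that [OF *(1-3) _ *(4)]) (simp add: False)
qed

section \<open>Propagation along connected subsets of a sphere\<close>

text \<open>
  At a nonreal point the germ of \<open>(\<alpha>, \<beta>)\<close> is determined by that of \<open>f\<close>, since two different imaginary
  units are available nearby.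
\<close>

lemma stem_rep_unique:
  assumes 1: "\<forall>\<^sub>F q in nhds p. stem_rep f \<alpha> \<beta> q"
    and 2: "\<forall>\<^sub>F q in nhds p. stem_rep f \<alpha>' \<beta>' q"
    and Im: "Im (half_plane_coord p) \<noteq> 0"
  shows "\<forall>\<^sub>F z in nhds (half_plane_coord p). \<alpha> z = \<alpha>' z \<and> \<beta> z = \<beta>' z"
proof -
  define z0 where "z0 = half_plane_coord p"
  have z0: "Im z0 > 0" using Im by (simp add: z0_def half_plane_coord_def)
  obtain I where I: "I \<in> \<S>" "slice_emb I z0 = p" using slice_emb_half_plane_coord unfolding z0_def by blast
  obtain V where V: "open V" "p \<in> V" "\<And>q. q \<in> V \<Longrightarrow> stem_rep f \<alpha> \<beta> q \<and> stem_rep f \<alpha>' \<beta>' q"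
    using eventually_conj [OF 1 2] unfolding eventually_nhds by blast
  have "open ((\<lambda>L. slice_emb L z0) -` V)"
    using V(1) by (intro open_vimage continuous_intros)
  moreover have "I \<in> (\<lambda>L. slice_emb L z0) -` V" using I V(2) by simp
  ultimately obtain e where e: "e > 0" "ball I e \<subseteq> (\<lambda>L. slice_emb L z0) -` V"
    using openE by blast
  obtain K where K: "K \<in> \<S>" "K \<noteq> I" "dist K I < e"
    using imag_unit_not_isolated [OF I(1) e(1)] by blast
  then have "K \<in> ball I e" by (simp add: dist_commute)
  then have KV: "slice_emb K z0 \<in> V" using e(2) by blast
  \<comment> \<open>On the upper half-plane the coordinate of \<open>slice_emb L z\<close> is \<open>z\<close> itself.\<close>
  define T where "T = {z. Im z > 0} \<inter> slice_emb I -` V \<inter> slice_emb K -` V"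
  have "open T"
    unfolding T_def using V(1) by (intro open_Int open_vimage open_halfspace_Im_gt continuous_intros)
  moreover have "z0 \<in> T" using z0 I V(2) KV by (simp add: T_def)
  moreover have "\<alpha> z = \<alpha>' z \<and> \<beta> z = \<beta>' z" if "z \<in> T" for z
  proof -
    have "\<alpha> z + L * \<beta> z = \<alpha>' z + L * \<beta>' z" if "L \<in> \<S>" "slice_emb L z \<in> V" for L
    proof -
      have "half_plane_coord (slice_emb L z) = z"
        using half_plane_coord_slice_emb [OF that(1), of z] \<open>z \<in> T\<close> by (simp add: T_def)
      with V(3) [OF that(2)] that(1) show ?thesis unfolding stem_rep_def by metis
    qed
    from affine_coefficients_unique [OF this this] I K \<open>z \<in> T\<close>
    show ?thesis by (auto simp: T_def)
  qed
  ultimately show ?thesis unfolding eventually_nhds z0_def by blast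
qed

text \<open>
  If \<open>y = 0\<close>, then \<open>C\<close> is a single point. Otherwise all points of the sphere share the same nonreal
  coordinate \<open>z0\<close> in the half-plane. Points of \<open>C\<close> that are close to each other have a common local
  representation, so by uniqueness the germ at \<open>z0\<close> of a representing pair is constant along \<open>C\<close>.
\<close>

lemma stem_rep_connected:
  assumes \<Omega>: "slice_domain \<Omega>" and f: "slice_regular_on \<Omega> f"
    and C: "connected C" "C \<subseteq> quat_sphere x y \<inter> \<Omega>"
    and p: "p \<in> C" "\<forall>\<^sub>F q in nhds p. stem_rep f \<alpha> \<beta> q" and p': "p' \<in> C"
  shows "\<forall>\<^sub>F q in nhds p'. stem_rep f \<alpha> \<beta> q"
proof (cases "y = 0")
  case True
  then have "p = p'" using C p(1) p' by (auto simp: quat_sphere_def)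
  then show ?thesis using p by simp
next
  case False
  define z0 where "z0 = Complex x \<bar>y\<bar>"
  have z0: "half_plane_coord q = z0" if "q \<in> C" for q
    using half_plane_coord_sphere C(2) that by (auto simp: z0_def)
  have "Im z0 \<noteq> 0" using False by (simp add: z0_def)
  show ?thesis
  proof (rule connected_induction_simple [OF C(1) p(1) p', where P = "\<lambda>p. \<forall>\<^sub>F q in nhds p. stem_rep f \<alpha> \<beta> q"])
    fix a assume a: "a \<in> C"
    then have "a \<in> \<Omega>" using C by blast
    from local_stem [OF \<Omega> f this]
    obtain \<alpha>' \<beta>' where "\<forall>\<^sub>F q in nhds a. stem_rep f \<alpha>' \<beta>' q" by metis
    then obtain V where V: "open V" "a \<in> V" "\<And>q. q \<in> V \<Longrightarrow> stem_rep f \<alpha>' \<beta>' q"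
      unfolding eventually_nhds by blast
    then have V_ev: "\<forall>\<^sub>F q in nhds b. stem_rep f \<alpha>' \<beta>' q" if "b \<in> V" for b
      using that unfolding eventually_nhds by blast
    show "\<exists>T. openin (top_of_set C) T \<and> a \<in> T \<and> (\<forall>b\<in>T. \<forall>c\<in>T.
        (\<forall>\<^sub>F q in nhds b. stem_rep f \<alpha> \<beta> q) \<longrightarrow> (\<forall>\<^sub>F q in nhds c. stem_rep f \<alpha> \<beta> q))"
    proof (intro exI conjI ballI impI)
      show "openin (top_of_set C) (C \<inter> V)" using V(1) by (rule openin_open_Int)
      show "a \<in> C \<inter> V" using a V(2) by blast
      fix b c assume b: "b \<in> C \<inter> V" and c: "c \<in> C \<inter> V"
        and ev: "\<forall>\<^sub>F q in nhds b. stem_rep f \<alpha> \<beta> q"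
      have "\<forall>\<^sub>F z in nhds z0. \<alpha> z = \<alpha>' z \<and> \<beta> z = \<beta>' z"
        using stem_rep_unique [OF ev V_ev] b z0 \<open>Im z0 \<noteq> 0\<close> by simp
      then obtain M where M: "open M" "z0 \<in> M" "\<And>z. z \<in> M \<Longrightarrow> \<alpha> z = \<alpha>' z \<and> \<beta> z = \<beta>' z"
        unfolding eventually_nhds by blast
      have "\<forall>\<^sub>F q in nhds c. half_plane_coord q \<in> M"
        using M(1,2) z0 c by (intro eventually_half_plane_coord) auto
      with V_ev c have "\<forall>\<^sub>F q in nhds c. stem_rep f \<alpha>' \<beta>' q \<and> half_plane_coord q \<in> M"
        by (simp add: eventually_conj)
      then show "\<forall>\<^sub>F q in nhds c. stem_rep f \<alpha> \<beta> q"
        by eventually_elim (simp add: stem_rep_def M(3))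
    qed
  qed (use p in auto)
qed

section \<open>Spherical expansion of holomorphic functions\<close>

lemma holomorphic_on_cnj_reflection:
  assumes "F holomorphic_on ball (of_real x) r"
  shows "(\<lambda>z. cnj (F (cnj z))) holomorphic_on ball (of_real x) r"
proof -
  have "dist (cnj z) (of_real x) = dist z (of_real x)" for z
    by (metis complex_cnj_complex_of_real complex_cnj_diff complex_mod_cnj dist_norm)
  then have "cnj z \<in> ball (of_real x) r \<longleftrightarrow> z \<in> ball (of_real x) r" for z
    by (simp add: dist_commute)
  then have "cnj ` ball (of_real x) r = ball (of_real x) r"
    by (auto simp del: mem_ball) (metis complex_cnj_cnj image_eqI)
  then have "(cnj \<circ> F \<circ> cnj) holomorphic_on ball (of_real x) r"
    using assms by (intro holomorphic_on_compose_cnj_cnj) auto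
  then show ?thesis by (simp add: o_def)
qed

text \<open>
  The coefficients are obtained by averaging the Taylor series with its reflection.
\<close>

lemma real_power_series:
  assumes G: "G holomorphic_on ball (of_real x) r"
    and cnj: "\<And>z. z \<in> ball (of_real x) r \<Longrightarrow> cnj (G (cnj z)) = G z"
  obtains a :: "nat \<Rightarrow> real" where
    "\<And>z. z \<in> ball (of_real x) r \<Longrightarrow> (\<lambda>n. of_real (a n) * (z - of_real x) ^ n) sums G z"
proof
  define g where "g n = (deriv ^^ n) G (of_real x) / fact n" for n
  have g: "(\<lambda>n. g n * (z - of_real x) ^ n) sums G z" if "z \<in> ball (of_real x) r" for z
    unfolding g_def using holomorphic_power_series [OF G that] .
  fix z assume z: "z \<in> ball (complex_of_real x) r"
  have "dist (cnj z) (of_real x) = dist z (of_real x)"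
    by (metis complex_cnj_complex_of_real complex_cnj_diff complex_mod_cnj dist_norm)
  then have "cnj z \<in> ball (of_real x) r" using z by (simp add: dist_commute)
  from sums_cnj [THEN iffD2, OF g [OF this]]
  have "(\<lambda>n. cnj (g n) * (z - of_real x) ^ n) sums G z"
    by (simp add: cnj [OF z])
  from sums_divide [OF sums_add [OF g [OF z] this], of 2]
  have "(\<lambda>n. (g n * (z - of_real x) ^ n + cnj (g n) * (z - of_real x) ^ n) / 2) sums G z"
    by simp
  moreover have "(g n * (z - of_real x) ^ n + cnj (g n) * (z - of_real x) ^ n) / 2
      = of_real (Re (g n)) * (z - of_real x) ^ n" for n
    by (simp add: complex_add_cnj flip: distrib_right)
  ultimately show "(\<lambda>n. of_real (Re (g n)) * (z - of_real x) ^ n) sums G z"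
    by simp
qed

text \<open>
  Let \<open>P z = (z - x)\<^sup>2 + y\<^sup>2\<close>. Near \<open>x + y i\<close> this is a local coordinate, with inverse
  \<open>\<psi> \<zeta> = x + i \<sigma> \<zeta>\<close> where \<open>\<sigma> \<zeta> = csqrt (y\<^sup>2 - \<zeta>)\<close>. The function \<open>F \<circ> \<psi>\<close> is \<open>U + i V\<close> with \<open>U\<close> and \<open>V\<close>
  real on the real axis, and therefore equals \<open>G0 + \<psi> G1\<close> with \<open>G1 = V / \<sigma>\<close> and \<open>G0 = U - x G1\<close>,
  which have real Taylor coefficients. It remains to substitute \<open>\<zeta> = P z\<close>.
\<close>

lemma spherical_expansion_nonreal:
  assumes F: "F holomorphic_on N" and N: "open N" "Complex x y \<in> N" and y: "y > 0"
  obtains M and a :: "nat \<Rightarrow> real" where "open M" "Complex x y \<in> M"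
    "\<And>z. z \<in> M \<Longrightarrow> (\<lambda>n. ((z - of_real x)\<^sup>2 + of_real (y\<^sup>2)) ^ n *
        (of_real (a (2 * n)) + z * of_real (a (2 * n + 1)))) sums F z"
proof -
  define \<sigma> where "\<sigma> \<zeta> = csqrt (of_real (y\<^sup>2) - \<zeta>)" for \<zeta> :: complex
  define \<psi> where "\<psi> \<zeta> = of_real x + \<i> * \<sigma> \<zeta>" for \<zeta>
  have slit: "of_real (y\<^sup>2) - \<zeta> \<notin> \<real>\<^sub>\<le>\<^sub>0" if "\<zeta> \<in> ball 0 (y\<^sup>2)" for \<zeta> :: complex
  proof -
    have "Re \<zeta> < y\<^sup>2" using that complex_Re_le_cmod [of \<zeta>] by simp
    then show ?thesis by (auto simp: complex_nonpos_Reals_iff)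
  qed
  have hol_\<sigma>: "\<sigma> holomorphic_on ball 0 (y\<^sup>2)"
    unfolding \<sigma>_def [abs_def] using slit by (intro holomorphic_intros) auto
  then have hol_\<psi>: "\<psi> holomorphic_on ball 0 (y\<^sup>2)"
    unfolding \<psi>_def [abs_def] by (intro holomorphic_intros)
  have "csqrt (of_real (y\<^sup>2)) = of_real y"
    using csqrt_square [of "of_real y"] y by simp
  then have \<psi>0: "\<psi> 0 = Complex x y"
    by (simp add: \<psi>_def \<sigma>_def complex_eq_iff)
  have "open (ball 0 (y\<^sup>2) \<inter> \<psi> -` N)"
    using holomorphic_on_imp_continuous_on [OF hol_\<psi>] N(1) by (simp add: continuous_open_preimage)
  moreover have "0 \<in> ball 0 (y\<^sup>2) \<inter> \<psi> -` N"
    using y N(2) by (simp add: \<psi>0)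
  ultimately obtain \<rho> where \<rho>: "\<rho> > 0" "ball 0 \<rho> \<subseteq> ball 0 (y\<^sup>2) \<inter> \<psi> -` N"
    using openE by blast
  define B :: "complex set" where "B = ball (of_real 0) \<rho>"
  have B: "B \<subseteq> ball 0 (y\<^sup>2)" "\<psi> ` B \<subseteq> N" using \<rho>(2) by (auto simp: B_def)
  have cnjB: "cnj \<zeta> \<in> B" if "\<zeta> \<in> B" for \<zeta> using that by (simp add: B_def)
  define H where "H \<zeta> = F (\<psi> \<zeta>)" for \<zeta>
  have hol_H: "H holomorphic_on B"
    using holomorphic_on_compose_gen [OF holomorphic_on_subset [OF hol_\<psi> B(1)] F B(2)]
    by (simp add: o_def H_def [abs_def])
  then have hol_H': "(\<lambda>\<zeta>. cnj (H (cnj \<zeta>))) holomorphic_on B"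
    unfolding B_def by (rule holomorphic_on_cnj_reflection)
  define U where "U \<zeta> = (H \<zeta> + cnj (H (cnj \<zeta>))) / 2" for \<zeta>
  define V where "V \<zeta> = - \<i> / 2 * (H \<zeta> - cnj (H (cnj \<zeta>)))" for \<zeta>
  define G1 where "G1 \<zeta> = V \<zeta> / \<sigma> \<zeta>" for \<zeta>
  define G0 where "G0 \<zeta> = U \<zeta> - of_real x * G1 \<zeta>" for \<zeta>
  have \<sigma>0: "\<sigma> \<zeta> \<noteq> 0" if "\<zeta> \<in> B" for \<zeta>
    using slit [of \<zeta>] that B(1) by (auto simp: \<sigma>_def)
  have "H \<zeta> = U \<zeta> + \<i> * V \<zeta>" for \<zeta>
    by (simp add: U_def V_def field_simps)
  then have H: "H \<zeta> = G0 \<zeta> + \<psi> \<zeta> * G1 \<zeta>" if "\<zeta> \<in> B" for \<zeta>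
    using \<sigma>0 [OF that] by (simp add: G0_def G1_def \<psi>_def algebra_simps)
  have hol_G1: "G1 holomorphic_on B"
    unfolding G1_def [abs_def] V_def [abs_def] using \<sigma>0
    by (intro holomorphic_intros hol_H hol_H' holomorphic_on_subset [OF hol_\<sigma> B(1)]) auto
  then have hol_G0: "G0 holomorphic_on B"
    unfolding G0_def [abs_def] U_def [abs_def]
    by (intro holomorphic_intros hol_H hol_H') auto
  have \<sigma>c: "cnj (\<sigma> (cnj \<zeta>)) = \<sigma> \<zeta>" if "\<zeta> \<in> B" for \<zeta>
    using cnj_csqrt [of "of_real (y\<^sup>2) - cnj \<zeta>"] slit [of "cnj \<zeta>"] cnjB [OF that] B(1)
    by (auto simp: \<sigma>_def simp del: mem_ball_0 mem_ball)
  have G1c: "cnj (G1 (cnj \<zeta>)) = G1 \<zeta>" if "\<zeta> \<in> B" for \<zeta>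
    by (simp add: G1_def V_def \<sigma>c [OF that] algebra_simps diff_divide_distrib)
  have G0c: "cnj (G0 (cnj \<zeta>)) = G0 \<zeta>" if "\<zeta> \<in> B" for \<zeta>
    by (simp add: G0_def U_def G1c [OF that] add.commute)
  obtain b0 where b0: "\<And>\<zeta>. \<zeta> \<in> B \<Longrightarrow> (\<lambda>n. of_real (b0 n) * (\<zeta> - of_real 0) ^ n) sums G0 \<zeta>"
    using real_power_series [OF hol_G0 [unfolded B_def]] G0c unfolding B_def by blast
  obtain b1 where b1: "\<And>\<zeta>. \<zeta> \<in> B \<Longrightarrow> (\<lambda>n. of_real (b1 n) * (\<zeta> - of_real 0) ^ n) sums G1 \<zeta>"
    using real_power_series [OF hol_G1 [unfolded B_def]] G1c unfolding B_def by blast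
  define P where "P z = (z - of_real x)\<^sup>2 + of_real (y\<^sup>2)" for z :: complex
  define M where "M = {z. Im z > 0} \<inter> P -` B"
  define a where "a k = (if even k then b0 (k div 2) else b1 (k div 2))" for k
  show ?thesis
  proof
    show "open M"
      unfolding M_def P_def B_def
      by (intro open_Int open_vimage open_halfspace_Im_gt continuous_intros) auto
    have "P (Complex x y) = 0"
      by (simp add: P_def complex_eq_iff power2_eq_square)
    then show "Complex x y \<in> M" using y \<rho>(1) by (simp add: M_def B_def)
    fix z assume "z \<in> M"
    then have z: "Im z > 0" "P z \<in> B" by (auto simp: M_def)
    \<comment> \<open>The choice of the principal branch is right since \<open>Im z > 0\<close>.\<close>
    have "of_real (y\<^sup>2) - P z = (- \<i> * (z - of_real x))\<^sup>2"
      by (simp add: P_def power_mult_distrib)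
    then have "\<sigma> (P z) = - \<i> * (z - of_real x)"
      using z(1) csqrt_square [of "- \<i> * (z - of_real x)"] by (simp add: \<sigma>_def)
    then have \<psi>z: "\<psi> (P z) = z" by (simp add: \<psi>_def)
    have "(\<lambda>n. of_real (b0 n) * P z ^ n + z * (of_real (b1 n) * P z ^ n)) sums (G0 (P z) + z * G1 (P z))"
      using b0 [OF z(2)] b1 [OF z(2)] by (intro sums_add sums_mult) simp_all
    also have "G0 (P z) + z * G1 (P z) = F z"
      using H [OF z(2)] by (simp add: \<psi>z H_def)
    finally show "(\<lambda>n. ((z - of_real x)\<^sup>2 + of_real (y\<^sup>2)) ^ n *
        (of_real (a (2 * n)) + z * of_real (a (2 * n + 1)))) sums F z"
      by (simp add: a_def P_def algebra_simps)
  qed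
qed

text \<open>
  Here the expansion is the Taylor series at \<open>x\<close>, whose terms of degree \<open>2 n\<close> and \<open>2 n + 1\<close> are
  collected; the coefficients are real because \<open>F\<close> is real on the real axis.
\<close>

lemma spherical_expansion_real:
  assumes F: "F holomorphic_on N" and N: "open N" "complex_of_real x \<in> N"
    and real: "\<And>t. of_real t \<in> N \<Longrightarrow> F (of_real t) \<in> \<real>"
  obtains M and a :: "nat \<Rightarrow> real" where "open M" "of_real x \<in> M"
    "\<And>z. z \<in> M \<Longrightarrow> (\<lambda>n. ((z - of_real x)\<^sup>2) ^ n *
        (of_real (a (2 * n)) + z * of_real (a (2 * n + 1)))) sums F z"
proof -
  obtain r where r: "r > 0" "ball (of_real x) r \<subseteq> N" using N openE by blast
  define B where "B = ball (complex_of_real x) r"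
  have B: "B \<subseteq> N" "open B" "connected B" "of_real x \<in> B" using r by (auto simp: B_def)
  have hol: "F holomorphic_on B" using F B(1) by (rule holomorphic_on_subset)
  have "cnj (F (cnj z)) - F z = 0" if z: "z \<in> B" for z
  proof (rule analytic_continuation [OF _ B(2,3) _ B(4) islimpt_Reals [OF B(2,4)] _ z])
    show "(\<lambda>z. cnj (F (cnj z)) - F z) holomorphic_on B"
      using hol holomorphic_on_cnj_reflection [of F x r] unfolding B_def
      by (intro holomorphic_intros)
    show "cnj (F (cnj z)) - F z = 0" if "z \<in> B \<inter> \<real>" for z
    proof -
      have "z \<in> \<real>" "F z \<in> \<real>" using that real B(1) by (auto elim!: Reals_cases)
      then show ?thesis by (simp add: Reals_cnj_iff)
    qed
  qed auto
  with real_power_series [of F x r] hol obtain c where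
    c: "\<And>z. z \<in> B \<Longrightarrow> (\<lambda>n. of_real (c n) * (z - of_real x) ^ n) sums F z"
    unfolding B_def by auto
  \<comment> \<open>\<open>c k + (z - x) c (k + 1) = (c k - x c (k + 1)) + z c (k + 1)\<close>\<close>
  define a where "a k = (if even k then c k - x * c (k + 1) else c k)" for k
  show ?thesis
  proof (rule that [OF B(2,4)])
    fix z assume "z \<in> B"
    have "{n * 2..<n * 2 + 2} = {2 * n, 2 * n + 1}" for n :: nat by auto
    with sums_group [OF c [OF \<open>z \<in> B\<close>], of 2]
    have "(\<lambda>n. of_real (c (2 * n)) * (z - of_real x) ^ (2 * n) +
        of_real (c (2 * n + 1)) * (z - of_real x) ^ (2 * n + 1)) sums F z"
      by (simp add: mult.commute)
    moreover have "of_real (c (2 * n)) * (z - of_real x) ^ (2 * n) +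
        of_real (c (2 * n + 1)) * (z - of_real x) ^ (2 * n + 1) =
        ((z - of_real x)\<^sup>2) ^ n * (of_real (a (2 * n)) + z * of_real (a (2 * n + 1)))" for n
      by (simp add: a_def power_mult [symmetric] algebra_simps)
    ultimately show "(\<lambda>n. ((z - of_real x)\<^sup>2) ^ n *
        (of_real (a (2 * n)) + z * of_real (a (2 * n + 1)))) sums F z" by simp
  qed
qed

lemma spherical_expansion:
  assumes "F holomorphic_on N" "open N" "Complex x y \<in> N" "y \<ge> 0"
    and "y = 0 \<Longrightarrow> (\<And>t. of_real t \<in> N \<Longrightarrow> F (of_real t) \<in> \<real>)"
  shows "\<exists>M (a :: nat \<Rightarrow> real). open M \<and> Complex x y \<in> M \<and>
    (\<forall>z\<in>M. (\<lambda>n. ((z - of_real x)\<^sup>2 + of_real (y\<^sup>2)) ^ n *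
        (of_real (a (2 * n)) + z * of_real (a (2 * n + 1)))) sums F z)"
proof (cases "y = 0")
  case True
  then have x: "Complex x y = of_real x" by (simp add: complex_eq_iff)
  obtain M and a :: "nat \<Rightarrow> real" where "open M" "of_real x \<in> M"
    "\<And>z. z \<in> M \<Longrightarrow> (\<lambda>n. ((z - of_real x)\<^sup>2) ^ n *
        (of_real (a (2 * n)) + z * of_real (a (2 * n + 1)))) sums F z"
    using spherical_expansion_real [OF assms(1,2) assms(3) [unfolded x] assms(5) [OF True]] by blast
  then show ?thesis
    unfolding x by (intro exI [of _ M] exI [of _ a]) (simp add: True)
next
  case False
  with assms(4) have "y > 0" by simp
  obtain M and a :: "nat \<Rightarrow> real" where "open M" "Complex x y \<in> M"
    "\<And>z. z \<in> M \<Longrightarrow> (\<lambda>n. ((z - of_real x)\<^sup>2 + of_real (y\<^sup>2)) ^ n *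
        (of_real (a (2 * n)) + z * of_real (a (2 * n + 1)))) sums F z"
    using spherical_expansion_nonreal [OF assms(1-3) \<open>y > 0\<close>] by blast
  then show ?thesis
    by (intro exI [of _ M] exI [of _ a]) simp
qed

section \<open>The expansion on the quaternions\<close>

text \<open>
  Each coordinate of \<open>\<alpha> + i \<beta>\<close> is a complex holomorphic function. Since the coefficients of its expansion
  are real, the embedding of \<open>\<complex>\<close> onto the slice of \<open>L\<close> carries the expansion to one with the same
  coefficients for every \<open>L\<close>; adding up the coordinates gives quaternionic coefficients on the right.
\<close>

lemma stem_expansion:
  assumes stem: "stem_on N \<alpha> \<beta>" and N: "open N" "Complex x y \<in> N" and y: "y \<ge> 0"
    and real: "y = 0 \<Longrightarrow> (\<And>t. of_real t \<in> N \<Longrightarrow> \<beta> (of_real t) = 0)"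
  obtains M and a :: "nat \<Rightarrow> quat" where "open M" "Complex x y \<in> M"
    "\<And>z L. z \<in> M \<Longrightarrow> L \<in> \<S> \<Longrightarrow> (\<lambda>n. ((slice_emb L z - of_real x)\<^sup>2 + of_real (y\<^sup>2)) ^ n *
        (a (2 * n) + slice_emb L z * a (2 * n + 1))) sums (\<alpha> z + L * \<beta> z)"
proof -
  define F where "F b z = complex_of_real (inner (\<alpha> z) b) + \<i> * of_real (inner (\<beta> z) b)" for b z
  have "F b holomorphic_on N" for b
  proof (rule holomorphic_on_complex_linear_derivative [OF N(1)])
    fix z assume "z \<in> N"
    then obtain A B where AB: "(\<alpha> has_derivative A) (at z)" "(\<beta> has_derivative B) (at z)"
      "\<And>w. A (\<i> * w) = - B w" "\<And>w. B (\<i> * w) = A w"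
      using stem unfolding stem_on_def by blast
    define D where "D w = complex_of_real (inner (A w) b) + \<i> * of_real (inner (B w) b)" for w
    have "(F b has_derivative D) (at z)"
      unfolding F_def [abs_def] D_def [abs_def] using AB(1,2) by (intro derivative_intros) auto
    moreover have "D (\<i> * w) = \<i> * D w" for w
      by (simp add: D_def AB(3,4) algebra_simps)
    ultimately show "\<exists>D. (F b has_derivative D) (at z) \<and> (\<forall>w. D (\<i> * w) = \<i> * D w)"
      by blast
  qed
  then have "\<exists>M (a :: nat \<Rightarrow> real). open M \<and> Complex x y \<in> M \<and>
    (\<forall>z\<in>M. (\<lambda>n. ((z - of_real x)\<^sup>2 + of_real (y\<^sup>2)) ^ n *
        (of_real (a (2 * n)) + z * of_real (a (2 * n + 1)))) sums F b z)" for b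
    by (rule spherical_expansion [OF _ N y]) (simp add: F_def real)
  then have "\<exists>M. \<forall>b. \<exists>a :: nat \<Rightarrow> real. open (M b) \<and> Complex x y \<in> M b \<and>
    (\<forall>z\<in>M b. (\<lambda>n. ((z - of_real x)\<^sup>2 + of_real (y\<^sup>2)) ^ n *
        (of_real (a (2 * n)) + z * of_real (a (2 * n + 1)))) sums F b z)"
    by (intro choice allI)
  then obtain M where "\<exists>a. \<forall>b. open (M b) \<and> Complex x y \<in> M b \<and>
    (\<forall>z\<in>M b. (\<lambda>n. ((z - of_real x)\<^sup>2 + of_real (y\<^sup>2)) ^ n *
        (of_real (a b (2 * n) :: real) + z * of_real (a b (2 * n + 1)))) sums F b z)"
    by (elim exE) (rule that, rule choice)
  then obtain a :: "quat \<Rightarrow> nat \<Rightarrow> real" where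
    M: "\<And>b. open (M b)" "\<And>b. Complex x y \<in> M b" and
    a: "\<And>b z. z \<in> M b \<Longrightarrow> (\<lambda>n. ((z - of_real x)\<^sup>2 + of_real (y\<^sup>2)) ^ n *
        (of_real (a b (2 * n)) + z * of_real (a b (2 * n + 1)))) sums F b z"
    by (elim exE) blast
  define c where "c n = (\<Sum>b\<in>Basis. a b n *\<^sub>R b)" for n
  show ?thesis
  proof
    show "open (\<Inter>b\<in>Basis. M b)" "Complex x y \<in> (\<Inter>b\<in>Basis. M b)"
      using M by auto
    fix z L assume z: "z \<in> (\<Inter>b\<in>Basis. M b)" and L: "L \<in> \<S>"
    define P where "P = (z - of_real x)\<^sup>2 + of_real (y\<^sup>2)"
    define Q where "Q = (slice_emb L z - of_real x)\<^sup>2 + of_real (y\<^sup>2)"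
    have Q: "slice_emb L P = Q"
      by (simp only: P_def Q_def slice_emb_add slice_emb_power [OF L] slice_emb_of_real
          linear_diff [OF bounded_linear.linear [OF bounded_linear_slice_emb]])
    have "(\<lambda>n. slice_emb L (P ^ n *
        (of_real (a b (2 * n)) + z * of_real (a b (2 * n + 1)))) * b) sums (slice_emb L (F b z) * b)"
      if "b \<in> Basis" for b
      using z that unfolding P_def by (intro sums_mult2 bounded_linear.sums [OF bounded_linear_slice_emb] a) auto
    then have "(\<lambda>n. Q ^ n * (of_real (a b (2 * n)) + slice_emb L z * of_real (a b (2 * n + 1))) * b)
        sums (slice_emb L (F b z) * b)" if "b \<in> Basis" for b
      using that by (simp only: slice_emb_mult [OF L] slice_emb_power [OF L] Q slice_emb_add slice_emb_of_real)
    then have "(\<lambda>n. \<Sum>b\<in>Basis. Q ^ n * (of_real (a b (2 * n)) + slice_emb L z * of_real (a b (2 * n + 1))) * b)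
        sums (\<Sum>b\<in>Basis. slice_emb L (F b z) * b)"
      by (rule sums_sum)
    moreover have "(\<Sum>b\<in>Basis. Q ^ n * (of_real (a b (2 * n)) + slice_emb L z * of_real (a b (2 * n + 1))) * b)
        = Q ^ n * (c (2 * n) + slice_emb L z * c (2 * n + 1))" for n
      by (simp add: c_def sum_distrib_left distrib_left distrib_right sum.distrib of_real_def mult.assoc)
    moreover have "(\<Sum>b\<in>Basis. slice_emb L (F b z) * b) = \<alpha> z + L * \<beta> z"
    proof -
      have "slice_emb L (F b z) * b = inner (\<alpha> z) b *\<^sub>R b + L * (inner (\<beta> z) b *\<^sub>R b)" for b
        by (simp add: F_def slice_emb_def of_real_def distrib_right)
      then have "(\<Sum>b\<in>Basis. slice_emb L (F b z) * b) =
          (\<Sum>b\<in>Basis. inner (\<alpha> z) b *\<^sub>R b) + L * (\<Sum>b\<in>Basis. inner (\<beta> z) b *\<^sub>R b)"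
        by (simp add: sum.distrib sum_distrib_left)
      then show ?thesis by (simp only: euclidean_representation)
    qed
    ultimately show "(\<lambda>n. ((slice_emb L z - of_real x)\<^sup>2 + of_real (y\<^sup>2)) ^ n *
        (c (2 * n) + slice_emb L z * c (2 * n + 1))) sums (\<alpha> z + L * \<beta> z)"
      by (simp add: Q_def)
  qed
qed

theorem theorem12p1:
  fixes \<Omega> C :: "quat set" and f :: "quat \<Rightarrow> quat" and x0 y0 :: real
  assumes "slice_domain \<Omega>"
    and "slice_regular_on \<Omega> f"
    and "quat_sphere x0 y0 \<inter> \<Omega> \<noteq> {}"
    and "C \<in> components (quat_sphere x0 y0 \<inter> \<Omega>)"
  shows "\<exists>(U :: quat set) (a :: nat \<Rightarrow> quat).
    open U \<and> C \<subseteq> U \<and> U \<subseteq> \<Omega> \<and>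
    (\<forall>q\<in>U. (\<lambda>n. ((q - of_real x0)\<^sup>2 + of_real (y0\<^sup>2)) ^ n * (a (2 * n) + q * a (2 * n + 1)))
              sums f q)"
proof -
  have C: "connected C" "C \<subseteq> quat_sphere x0 y0 \<inter> \<Omega>" "C \<noteq> {}"
    using in_components_connected [OF assms(4)] in_components_subset [OF assms(4)]
      in_components_nonempty [OF assms(4)] by blast+
  then obtain p where p: "p \<in> C" by blast
  have z0: "half_plane_coord q = Complex x0 \<bar>y0\<bar>" if "q \<in> C" for q
    using half_plane_coord_sphere C(2) that by blast
  have p\<Omega>: "p \<in> \<Omega>" using p C(2) by blast
  obtain N \<alpha> \<beta> where
    N: "open N" "Complex x0 \<bar>y0\<bar> \<in> N" "stem_on N \<alpha> \<beta>"
    and real: "\<bar>y0\<bar> = 0 \<longrightarrow> (\<forall>t. of_real t \<in> N \<longrightarrow> \<beta> (of_real t) = 0)"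
    and rep: "\<forall>\<^sub>F q in nhds p. stem_rep f \<alpha> \<beta> q"
    by (rule local_stem [OF assms(1,2) p\<Omega>, unfolded z0 [OF p] complex.sel])
  have real': "\<beta> (of_real t) = 0" if "\<bar>y0\<bar> = 0" "of_real t \<in> N" for t
    using real that by blast
  obtain M and a :: "nat \<Rightarrow> quat" where
    M: "open M" "Complex x0 \<bar>y0\<bar> \<in> M" and
    a: "\<And>z L. z \<in> M \<Longrightarrow> L \<in> \<S> \<Longrightarrow> (\<lambda>n. ((slice_emb L z - of_real x0)\<^sup>2 + of_real (y0\<^sup>2)) ^ n *
        (a (2 * n) + slice_emb L z * a (2 * n + 1))) sums (\<alpha> z + L * \<beta> z)"
    by (rule stem_expansion [OF N(3,1,2) abs_ge_zero real', unfolded power2_abs]) (assumption+, rule that)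
  define S where "S = {q \<in> \<Omega>. (\<lambda>n. ((q - of_real x0)\<^sup>2 + of_real (y0\<^sup>2)) ^ n *
      (a (2 * n) + q * a (2 * n + 1))) sums f q}"
  have "C \<subseteq> interior S"
  proof
    fix p' assume p': "p' \<in> C"
    have "\<forall>\<^sub>F q in nhds p'. stem_rep f \<alpha> \<beta> q"
      using stem_rep_connected [OF assms(1,2) C(1,2) p rep p'] .
    moreover have "\<forall>\<^sub>F q in nhds p'. half_plane_coord q \<in> M"
      using M z0 [OF p'] by (intro eventually_half_plane_coord) auto
    moreover have "\<forall>\<^sub>F q in nhds p'. q \<in> \<Omega>"
      using assms(1) p' C(2) by (intro eventually_nhds_in_open) (auto simp: slice_domain_def)
    ultimately have "\<forall>\<^sub>F q in nhds p'. q \<in> S"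
    proof eventually_elim
      case (elim q)
      obtain L where L: "L \<in> \<S>" "slice_emb L (half_plane_coord q) = q" using slice_emb_half_plane_coord by blast
      with elim(1) have "f q = \<alpha> (half_plane_coord q) + L * \<beta> (half_plane_coord q)"
        unfolding stem_rep_def by blast
      with a [OF elim(2) L(1)] elim(3) show ?case by (simp add: S_def L(2))
    qed
    then show "p' \<in> interior S"
      unfolding eventually_nhds by (auto intro: interiorI)
  qed
  moreover have "interior S \<subseteq> S" by (rule interior_subset)
  ultimately show ?thesis
    by (intro exI [of _ "interior S"] exI [of _ a]) (auto simp: S_def)
qed

end
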